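(* Let $P$ be a plant, $\hat M$ a corresponding finite state machine (with actual state set $\mathcal Q$ and state transition function $f$) and $\Delta$ the corresponding error system, all as described in the context. If there exist a function $V:\mathcal Q\to\mathbb R$ and a $\gamma\in(0,1)$ such that $$V(f(q,u,y))-V(q)\le\gamma\rho(u)-d(q)$$ holds for all $q\in\mathcal Q$, $u\in\mathcal U$ and $y\in\mathcal Y$, where $d:\mathcal Q\to\{0,1\}$ is defined by $$d(q)=\begin{cases}0&\text{if } q=\mathcal P_1(q)\text{ or } q=\mathcal P_{-1}(q)\\1&\text{otherwise,}\end{cases}$$ then the error system $\Delta$ with $\hat M$ initialized to $q_o$ satisfies the gain condition for that choice of $\gamma$: every feasible input/output pair of signals $(\mathbf u,\mathbf w)\in\mathcal U^{\mathbb Z_+}\times\mathcal W^{\mathbb Z_+}$ of $\Delta$ satisfies $$\inf_{T\ge0}\sum_{t=0}^{T}\big(\gamma\rho(u(t))-\mu(w(t))\big)>-\infty .$$ Here $\rho:\mathcal U\to\{1\}$ is the constant function $1$ and $\mu:\mathcal W\to\mathbb R_+$ is $\mu(w)=w$.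
   Context: **Plant.** $\mathbb Z_+$ is the set of non-negative integers, $\mathbb R_+$ the non-negative reals, $\mathcal U=\{0,1\}$, $\mathcal Y=\{-1,1\}$, $\mathcal W=\{0,1\}$; for a set $A$, $A^{\mathbb Z_+}$ is the set of infinite sequences in $A$. The plant $P$ is the discrete-time system $$x(t+1)=f_{u(t)}(x(t)),\quad y(t)=\mathrm{sign}(c'x(t)),\quad v(t)=\log\Big(\frac{\|x(t+1)\|}{\|x(t)\|}\Big),$$ with $t\in\mathbb Z_+$, state $x(t)\in\mathbb R^2$, performance output $v(t)\in\mathbb R$, control input $u(t)\in\mathcal U$ and sensor output $y(t)\in\mathcal Y$, with the understanding that when $c'x=0$, $y$ is taken to be $+1$ in one quadrant and $-1$ in the other. Here $\|\cdot\|$ is the Euclidean norm, and the functions $f_u=(f_{u1},f_{u2})':\mathbb R^2\to\mathbb R^2$ and the vector $c=(c_1,c_2)'\in\mathbb R^2$, $c\ne0$, are given. For each $u\in\{0,1\}$, $f_u$ is continuous and homogeneous with degree 1, i.e. $f_u(\alpha x)=\alpha f_u(x)$ for all $\alpha\in\mathbb R$, $x\in\mathbb R^2$. With $\beta(\theta)=(\cos\theta,\sin\theta)'$ and polar coordinates $r=\|x\|$, $\theta=\tan^{-1}(x_2/x_1)$ (the polar angle of $x$), the plant satisfies $\theta(t+1)=\tan^{-1}\Big(\frac{f_{u(t)2}(\beta(\theta(t)))}{f_{u(t)1}(\beta(\theta(t)))}\Big)$, $y(t)=\mathrm{sign}(c'\beta(\theta(t)))$ and $v(t)=\log\|f_{u(t)}(\beta(\theta(t)))\|$.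 **Partition and potential states.** For some integer $n>0$, the unit circle is partitioned into intervals $I_1,\dots,I_{2n}$, $I_i=[\alpha_i,\alpha_{i+1})$, for angles $\alpha_1<\dots<\alpha_{2n+1}$ satisfying $\alpha_1=\tan^{-1}(-c_1/c_2)$ with $\alpha_1\in[0,\pi)$, $\alpha_{n+1}=\alpha_1+\pi$, $\alpha_{2n+1}=\alpha_1+2\pi$. The partition is to be such that the outputs $y$ associated with all states of $P$ whose angular coordinates lie in any given interval are identical. The set of potential states is $\hat{\mathcal Q}=S_1\cup S_2\cup\dots\cup S_{2n}$, where $S_k$ is the set of all unions of $k$ (cyclically) adjacent intervals: $S_1=\{I_1,\dots,I_{2n}\}$, $S_2=\{I_1\cup I_2,I_2\cup I_3,\dots,I_{2n}\cup I_1\}$, ..., $S_{2n}=\{I_1\cup\dots\cup I_{2n}\}$; it has $2n(2n-1)+1$ distinct elements. Let $q_o=[\alpha_1,\alpha_{2n+1})$ be the state corresponding to the whole unit circle. For $q\in\hat{\mathcal Q}$, let $$\mathcal P_1(q)=\begin{cases}q\cap[\alpha_1,\alpha_{n+1})&\text{if }\mathrm{sign}(c'\beta(\alpha_2))=1\\ q\cap[\alpha_{n+1},\alpha_{2n+1})&\text{otherwise}\end{cases}\qquad \mathcal P_{-1}(q)=\begin{cases}q\cap[\alpha_1,\alpha_{n+1})&\text{if }\mathrm{sign}(c'\beta(\alpha_2))=-1\\ q\cap[\alpha_{n+1},\alpha_{2n+1})&\text{otherwise}\end{cases}$$ It is asserted as part of the construction that $\mathcal P_1(q),\mathcal P_{-1}(q)\in\hat{\mathcal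 Q}$. For $u\in\mathcal U$, $q\in\hat{\mathcal Q}$, let $q_+^u=\tan^{-1}\Big(\frac{f_{u2}(\beta(q))}{f_{u1}(\beta(q))}\Big)$ (the set of polar angles of $f_u(\beta(\theta))$, $\theta\in q$) and $\mathcal I_q^u=\{i\in\{1,\dots,2n\}: q_+^u\cap[\alpha_i,\alpha_{i+1})\neq\emptyset\}$. **The machine $\hat M$.** Define $\hat f:\hat{\mathcal Q}\times\mathcal U\times\mathcal Y\to\hat{\mathcal Q}$, $\hat g:\hat{\mathcal Q}\to\mathcal Y$, $\hat h:\hat{\mathcal Q}\times\mathcal U\to\mathcal V$ ($\mathcal V$ a finite subset of $\mathbb R$) by $$\hat f(q,u,\tilde y)=\bigcup_{i\in\mathcal I^u_{\mathcal P_{\tilde y}(q)}}[\alpha_i,\alpha_{i+1}),\qquad \hat h(q,u)=\sup_{\theta\in q}\log\big(\|f_u(\beta(\theta))\|\big),$$ $$\hat g(q)=\begin{cases}1&\text{if } q=\mathcal P_1(q)\text{ or }|\mathcal P_1(q)|\ge|\mathcal P_{-1}(q)|\\-1&\text{if } q=\mathcal P_{-1}(q)\text{ or }|\mathcal P_1(q)|<|\mathcal P_{-1}(q)|\end{cases}$$ where $|\cdot|$ denotes length of an interval. The initial state of $\hat M$ is fixed to $q_o$, and the set $\mathcal Q$ of actual states of $\hat M$ consists of those states in $\hat{\mathcal Q}$ that are reachable from $q_o$. The machine $\hat M$ has inputs $u\in\mathcal U$, $\tilde y\in\mathcal Y$ and dynamics $$q(t+1)=f(q(t),u(t),\tilde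 y(t)),\quad \hat y(t)=g(q(t)),\quad \hat v(t)=h(q(t),u(t)),$$ where $f=\hat f|_{\mathcal Q\times\mathcal U\times\mathcal Y}$, $g=\hat g|_{\mathcal Q}$, $h=\hat h|_{\mathcal Q\times\mathcal U}$. **Error system $\Delta$.** $\Delta$ has input $u$ and output $w\in\mathcal W$; it contains $P$ driven by $u$, with sensor output $y$, and a copy of $\hat M$ driven by $u$ and $y$ (in place of $\tilde y$), with output $\hat y$; $w=0$ if $y=\hat y$ and $w=1$ if $y\neq\hat y$. A feasible input/output pair $(\mathbf u,\mathbf w)$ of $\Delta$ is an input $\mathbf u\in\mathcal U^{\mathbb Z_+}$ together with a corresponding output $\mathbf w\in\mathcal W^{\mathbb Z_+}$, for some initial condition of $P$. *)

theory Defs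
  imports "HOL-Analysis.Analysis"
begin

definition inputs :: "nat set" where
  "inputs = {0, 1}"

definition outputs :: "int set" where
  "outputs = {-1, 1}"

definition beta :: "real \<Rightarrow> real^2" where
  "beta \<theta> = vector [cos \<theta>, sin \<theta>]"

text \<open>Polar angles are determined only modulo \<open>2 * pi\<close>, and the origin has none.\<close>

definition polar_angle :: "real^2 \<Rightarrow> real \<Rightarrow> bool" where
  "polar_angle x \<theta> \<longleftrightarrow> x \<noteq> 0 \<and> x = norm x *\<^sub>R beta \<theta>"

text \<open>The sign of \<open>c \<bullet> x\<close> with values in \<open>{-1, 1}\<close>.  The line \<open>c \<bullet> x = 0\<close> consists of two
  opposite rays (and the origin); \<open>b\<close> is the value on the ray through \<open>(-c\<^sub>2, c\<^sub>1)\<close>, and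
  \<open>-b\<close> the one on the opposite ray.  The value at the origin is never used.\<close>

definition sensor :: "int \<Rightarrow> real^2 \<Rightarrow> real^2 \<Rightarrow> int" where
  "sensor b c x =
    (if c \<bullet> x > 0 then 1
     else if c \<bullet> x < 0 then -1
     else if vector [- (c $ 2), c $ 1] \<bullet> x > 0 then b
     else - b)"

definition plant :: "(nat \<Rightarrow> real^2 \<Rightarrow> real^2) \<Rightarrow> real^2 \<Rightarrow> int \<Rightarrow> bool" where
  "plant f c b \<longleftrightarrow>
    c \<noteq> 0 \<and> b \<in> outputs \<and>
    (\<forall>u\<in>inputs. continuous_on UNIV (f u) \<and> (\<forall>a x. f u (a *\<^sub>R x) = a *\<^sub>R f u x))"

text \<open>The performance output \<open>v\<close> is a real number only as long as the state is nonzero, and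
  the polar coordinates also need this; so trajectories avoid the origin.\<close>

definition plant_run ::
  "(nat \<Rightarrow> real^2 \<Rightarrow> real^2) \<Rightarrow> real^2 \<Rightarrow> int \<Rightarrow>
   (nat \<Rightarrow> nat) \<Rightarrow> (nat \<Rightarrow> real^2) \<Rightarrow> (nat \<Rightarrow> int) \<Rightarrow> (nat \<Rightarrow> real) \<Rightarrow> bool" where
  "plant_run f c b u x y v \<longleftrightarrow>
    (\<forall>t. x t \<noteq> 0 \<and>
         x (Suc t) = f (u t) (x t) \<and>
         y t = sensor b c (x t) \<and>
         v t = ln (norm (x (Suc t)) / norm (x t)))"

text \<open>The value of \<open>tan\<^sup>-\<^sup>1 (- c\<^sub>1 / c\<^sub>2)\<close> in \<open>[0, pi)\<close>, with the quotient read as infinite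
  if \<open>c\<^sub>2 = 0\<close>.\<close>

definition line_angle :: "real^2 \<Rightarrow> real" where
  "line_angle c =
    (if c $ 2 = 0 then pi / 2
     else let a = arctan (- (c $ 1) / c $ 2) in if a < 0 then a + pi else a)"

definition arc :: "(nat \<Rightarrow> real) \<Rightarrow> nat \<Rightarrow> real set" where
  "arc \<alpha> i = {\<alpha> i..<\<alpha> (i + 1)}"

text \<open>The circle is represented by \<open>[\<alpha> 1, \<alpha> (2 * n + 1))\<close>.  The last clause fixes the
  convention for the sensor on the line \<open>c \<bullet> x = 0\<close>: since the arcs contain their left
  endpoints, it forces \<open>b = -1\<close>.\<close>

definition circle_partition :: "real^2 \<Rightarrow> int \<Rightarrow> nat \<Rightarrow> (nat \<Rightarrow> real) \<Rightarrow> bool" where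
  "circle_partition c b n \<alpha> \<longleftrightarrow>
    n > 0 \<and>
    (\<forall>i\<in>{1..2*n}. \<alpha> i < \<alpha> (i + 1)) \<and>
    \<alpha> 1 = line_angle c \<and>
    \<alpha> (n + 1) = \<alpha> 1 + pi \<and>
    \<alpha> (2*n + 1) = \<alpha> 1 + 2 * pi \<and>
    (\<forall>i\<in>{1..2*n}. \<forall>\<theta>\<in>arc \<alpha> i. \<forall>\<theta>'\<in>arc \<alpha> i. \<forall>x x'.
       polar_angle x \<theta> \<and> polar_angle x' \<theta>' \<longrightarrow> sensor b c x = sensor b c x')"

definition whole_circle :: "nat \<Rightarrow> (nat \<Rightarrow> real) \<Rightarrow> real set" where
  "whole_circle n \<alpha> = {\<alpha> 1..<\<alpha> (2*n + 1)}"

definition proj :: "real^2 \<Rightarrow> int \<Rightarrow> nat \<Rightarrow> (nat \<Rightarrow> real) \<Rightarrow> int \<Rightarrow> real set \<Rightarrow> real set" where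
  "proj c b n \<alpha> y q =
    (if sensor b c (beta (\<alpha> 2)) = y then q \<inter> {\<alpha> 1..<\<alpha> (n + 1)}
     else q \<inter> {\<alpha> (n + 1)..<\<alpha> (2*n + 1)})"

text \<open>All representatives modulo \<open>2 * pi\<close> of the image angles are included, so that
  intersecting with arcs of \<open>[\<alpha> 1, \<alpha> (2 * n + 1))\<close> is meaningful.\<close>

definition image_angles ::
  "(nat \<Rightarrow> real^2 \<Rightarrow> real^2) \<Rightarrow> nat \<Rightarrow> real set \<Rightarrow> real set" where
  "image_angles f u q = {\<phi>. \<exists>\<theta>\<in>q. polar_angle (f u (beta \<theta>)) \<phi>}"

definition hit_arcs ::
  "(nat \<Rightarrow> real^2 \<Rightarrow> real^2) \<Rightarrow> nat \<Rightarrow> (nat \<Rightarrow> real) \<Rightarrow> nat \<Rightarrow> real set \<Rightarrow> nat set" where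
  "hit_arcs f n \<alpha> u q = {i \<in> {1..2*n}. image_angles f u q \<inter> arc \<alpha> i \<noteq> {}}"

definition fhat ::
  "(nat \<Rightarrow> real^2 \<Rightarrow> real^2) \<Rightarrow> real^2 \<Rightarrow> int \<Rightarrow> nat \<Rightarrow> (nat \<Rightarrow> real) \<Rightarrow>
   real set \<Rightarrow> nat \<Rightarrow> int \<Rightarrow> real set" where
  "fhat f c b n \<alpha> q u y = (\<Union>i\<in>hit_arcs f n \<alpha> u (proj c b n \<alpha> y q). arc \<alpha> i)"

text \<open>The two cases in the definition of the output overlap only for the empty set, where
  the value \<open>1\<close> is chosen.\<close>

definition ghat :: "real^2 \<Rightarrow> int \<Rightarrow> nat \<Rightarrow> (nat \<Rightarrow> real) \<Rightarrow> real set \<Rightarrow> int" where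
  "ghat c b n \<alpha> q =
    (if q = proj c b n \<alpha> 1 q \<or>
        measure lborel (proj c b n \<alpha> 1 q) \<ge> measure lborel (proj c b n \<alpha> (-1) q)
     then 1 else -1)"

text \<open>Angles at which \<open>f u\<close> vanishes contribute \<open>log 0 = -\<infinity>\<close> to the supremum, whereas
  \<open>ln 0 = 0\<close> in the library; they are left out.\<close>

definition hhat :: "(nat \<Rightarrow> real^2 \<Rightarrow> real^2) \<Rightarrow> real set \<Rightarrow> nat \<Rightarrow> real" where
  "hhat f q u = (SUP \<theta>\<in>{\<theta>\<in>q. f u (beta \<theta>) \<noteq> 0}. ln (norm (f u (beta \<theta>))))"

text \<open>Reachable states are unions of arcs, hence finitely many.  They are not required to be
  unions of adjacent arcs, since \<open>proj\<close> need not preserve this.  The empty set can be among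
  them: it is reached by a sensor value that is incompatible with the present state.\<close>

inductive_set actual_states ::
  "(nat \<Rightarrow> real^2 \<Rightarrow> real^2) \<Rightarrow> real^2 \<Rightarrow> int \<Rightarrow> nat \<Rightarrow> (nat \<Rightarrow> real) \<Rightarrow> real set set"
  for f c b n \<alpha> where
  init: "whole_circle n \<alpha> \<in> actual_states f c b n \<alpha>"
| step: "\<lbrakk>q \<in> actual_states f c b n \<alpha>; u \<in> inputs; y \<in> outputs\<rbrakk>
         \<Longrightarrow> fhat f c b n \<alpha> q u y \<in> actual_states f c b n \<alpha>"

definition machine_run ::
  "(nat \<Rightarrow> real^2 \<Rightarrow> real^2) \<Rightarrow> real^2 \<Rightarrow> int \<Rightarrow> nat \<Rightarrow> (nat \<Rightarrow> real) \<Rightarrow>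
   (nat \<Rightarrow> nat) \<Rightarrow> (nat \<Rightarrow> int) \<Rightarrow> (nat \<Rightarrow> real set) \<Rightarrow> (nat \<Rightarrow> int) \<Rightarrow> (nat \<Rightarrow> real) \<Rightarrow> bool" where
  "machine_run f c b n \<alpha> u y q yhat vhat \<longleftrightarrow>
    q 0 = whole_circle n \<alpha> \<and>
    (\<forall>t. q (Suc t) = fhat f c b n \<alpha> (q t) (u t) (y t) \<and>
         yhat t = ghat c b n \<alpha> (q t) \<and>
         vhat t = hhat f (q t) (u t))"

definition feasible ::
  "(nat \<Rightarrow> real^2 \<Rightarrow> real^2) \<Rightarrow> real^2 \<Rightarrow> int \<Rightarrow> nat \<Rightarrow> (nat \<Rightarrow> real) \<Rightarrow>
   (nat \<Rightarrow> nat) \<Rightarrow> (nat \<Rightarrow> nat) \<Rightarrow> bool" where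
  "feasible f c b n \<alpha> u w \<longleftrightarrow>
    (\<forall>t. u t \<in> inputs) \<and>
    (\<exists>x y v q yhat vhat.
       plant_run f c b u x y v \<and>
       machine_run f c b n \<alpha> u y q yhat vhat \<and>
       (\<forall>t. w t = (if y t = yhat t then 0 else 1)))"

definition ambiguity :: "real^2 \<Rightarrow> int \<Rightarrow> nat \<Rightarrow> (nat \<Rightarrow> real) \<Rightarrow> real set \<Rightarrow> real" where
  "ambiguity c b n \<alpha> q =
    (if q = proj c b n \<alpha> 1 q \<or> q = proj c b n \<alpha> (-1) q then 0 else 1)"

definition rho :: "nat \<Rightarrow> real" where
  "rho u = 1"

definition mu :: "nat \<Rightarrow> real" where
  "mu w = real w"

end

theory Submission
  imports Defs
begin

text \<open>
  The machine state over-approximates the plant's polar angle: if the angle of \<open>x t\<close> lies in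
  \<open>q t\<close>, then reading the sensor restricts it to \<open>proj (y t) (q t)\<close>, and the next state
  collects all arcs that the image of this set meets (lemma \<open>tracked_angle_step\<close>).  Hence if
  \<open>q t\<close> is contained in one half-circle, the sensor value is determined by \<open>q t\<close>, the machine
  predicts it correctly, and the error is \<open>0\<close>; so the error at time \<open>t\<close> is at most the
  ambiguity of \<open>q t\<close> (lemma \<open>prediction_correct\<close>).  Summing the dissipation inequality along
  the run telescopes, and the partial sums are bounded below by \<open>V (q (T + 1)) - V (q 0)\<close>,
  which is bounded because the machine has only finitely many states.

  One point is delicate.  The projections label the two half-circles by the sensor value at
  the angle \<open>\<alpha> 2\<close>.  For \<open>n \<ge> 2\<close> this angle is interior to the first half, but for \<open>n = 1\<close> it is
  the start of the second half, so that the two labels are exchanged.  Then the machine does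
  not track the angle of \<open>x t\<close>, but that of \<open>- x t\<close>: sensor and dynamics are odd, so the
  exchanged labels are right for the antipodal trajectory.  Both cases are treated together
  by following the angle of \<open>tracked n (x t)\<close>, which is \<open>x t\<close> or \<open>- x t\<close>.
\<close>

section \<open>Polar angles\<close>

lemma beta_components [simp]: "beta \<theta> $ 1 = cos \<theta>" "beta \<theta> $ 2 = sin \<theta>"
  by (simp_all add: beta_def)

lemma beta_add_pi: "beta (\<theta> + pi) = - beta \<theta>"
  by (simp add: vec_eq_iff forall_2)

lemma norm_beta [simp]: "norm (beta \<theta>) = 1"
  by (simp add: norm_eq_sqrt_inner inner_vec_def sum_2 flip: power2_eq_square)

lemma polar_angle_beta: "polar_angle (beta \<theta>) \<theta>"
  unfolding polar_angle_def by (metis norm_beta norm_zero scaleR_one zero_neq_one)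

lemma polar_angle_scale:
  assumes "r > 0"
  shows "polar_angle (r *\<^sub>R x) \<theta> \<longleftrightarrow> polar_angle x \<theta>"
  using assms by (auto simp: polar_angle_def simp flip: scaleR_scaleR)

text \<open>The library provides an angle in \<open>[0, 2 * pi)\<close>; it is applied to \<open>x\<close> rotated by \<open>- a\<close>.\<close>

lemma polar_angle_exists:
  assumes "x \<noteq> 0"
  obtains \<theta> where "\<theta> \<in> {a..<a + 2 * pi}" "polar_angle x \<theta>"
proof -
  define r where "r = norm x"
  have r: "r > 0" using assms by (simp add: r_def)
  define p where "p = x $ 1 / r"
  define s where "s = x $ 2 / r"
  have norm_sq: "r\<^sup>2 = (x $ 1)\<^sup>2 + (x $ 2)\<^sup>2"
    unfolding r_def power2_norm_eq_inner by (simp add: inner_vec_def sum_2 power2_eq_square)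
  have "p\<^sup>2 + s\<^sup>2 = ((x $ 1)\<^sup>2 + (x $ 2)\<^sup>2) / r\<^sup>2"
    by (simp add: p_def s_def power_divide add_divide_distrib)
  then have ps: "p\<^sup>2 + s\<^sup>2 = 1"
    using r unfolding norm_sq[symmetric] by simp
  have "(cos a * p + sin a * s)\<^sup>2 + (cos a * s - sin a * p)\<^sup>2
      = ((cos a)\<^sup>2 + (sin a)\<^sup>2) * (p\<^sup>2 + s\<^sup>2)"
    by algebra
  then have "(cos a * p + sin a * s)\<^sup>2 + (cos a * s - sin a * p)\<^sup>2 = 1"
    by (simp add: ps)
  then obtain t where t: "0 \<le> t" "t < 2 * pi" "cos a * p + sin a * s = cos t"
      "cos a * s - sin a * p = sin t"
    using sincos_total_2pi by metis
  have one: "(cos a)\<^sup>2 + (sin a)\<^sup>2 = 1" by simp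
  have "cos (a + t) = p" "sin (a + t) = s"
    unfolding cos_add sin_add t(3,4)[symmetric] using one by algebra+
  then have "x = r *\<^sub>R beta (a + t)"
    using r by (simp add: vec_eq_iff forall_2 p_def s_def)
  then have "polar_angle x (a + t)"
    using assms by (simp add: polar_angle_def r_def)
  with t show ?thesis by (intro that[of "a + t"]) auto
qed

section \<open>The sensor on the two half-circles\<close>

lemma sensor_outputs: "b \<in> outputs \<Longrightarrow> sensor b c x \<in> outputs"
  by (auto simp: sensor_def outputs_def)

lemma minus_neq_output_iff: "z \<in> outputs \<Longrightarrow> y \<in> outputs \<Longrightarrow> - z \<noteq> y \<longleftrightarrow> y = z"
  by (auto simp: outputs_def)

lemma sensor_scale: "r > 0 \<Longrightarrow> sensor b c (r *\<^sub>R x) = sensor b c x"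
  by (simp add: sensor_def zero_less_mult_iff mult_less_0_iff)

lemma sensor_polar_angle:
  assumes "polar_angle x \<theta>"
  shows "sensor b c x = sensor b c (beta \<theta>)"
proof -
  have "norm x > 0" "x = norm x *\<^sub>R beta \<theta>" using assms by (auto simp: polar_angle_def)
  then show ?thesis using sensor_scale by metis
qed

text \<open>On the line \<open>c \<bullet> x = 0\<close> this rests on the convention that the two opposite rays carry
  opposite values.\<close>

lemma sensor_minus:
  assumes "c \<noteq> 0" "x \<noteq> 0" "b \<in> outputs"
  shows "sensor b c (- x) = - sensor b c x"
proof (cases "c \<bullet> x = 0")
  case True
  have "vector [- (c $ 2), c $ 1] \<bullet> x \<noteq> 0"
  proof
    assume orth: "vector [- (c $ 2), c $ 1] \<bullet> x = 0"
    have 1: "c $ 1 * x $ 1 + c $ 2 * x $ 2 = 0" "c $ 1 * x $ 2 - c $ 2 * x $ 1 = 0"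
      using True orth by (simp_all add: inner_vec_def sum_2)
    have "((c $ 1)\<^sup>2 + (c $ 2)\<^sup>2) * ((x $ 1)\<^sup>2 + (x $ 2)\<^sup>2) = 0"
      using 1 by algebra
    then show False
      using assms(1,2) by (auto simp: vec_eq_iff forall_2 sum_power2_eq_zero_iff)
  qed
  with True show ?thesis by (auto simp: sensor_def)
qed (auto simp: sensor_def)

lemma line_angle_orthogonal: "c \<bullet> beta (line_angle c) = 0"
proof (cases "c $ 2 = 0")
  case True
  then show ?thesis by (simp add: line_angle_def inner_vec_def sum_2)
next
  case False
  define a where "a = arctan (- (c $ 1) / c $ 2)"
  have "cos a \<noteq> 0" by (simp add: a_def)
  moreover have "tan a = - (c $ 1) / c $ 2" by (simp add: a_def tan_arctan)
  ultimately have "c \<bullet> beta a = 0"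
    using False by (simp add: tan_def field_simps inner_vec_def sum_2)
  moreover have "line_angle c = a \<or> line_angle c = a + pi"
    using False by (simp add: line_angle_def a_def Let_def)
  ultimately show ?thesis by (auto simp: beta_add_pi)
qed

text \<open>With \<open>\<alpha> 1\<close> on the line \<open>c \<bullet> x = 0\<close>, the sign of \<open>c \<bullet> beta (\<alpha> 1 + s)\<close> is that of a
  constant times \<open>sin s\<close>.  The left endpoint is covered because the sensor is constant on
  the first arc.\<close>

lemma sensor_first_half:
  assumes c: "c \<noteq> 0" and part: "circle_partition c b n \<alpha>"
    and \<theta>: "\<theta> \<in> {\<alpha> 1..<\<alpha> (n + 1)}"
  shows "sensor b c (beta \<theta>) = sensor b c (beta (\<alpha> 1))"
proof -
  define K where "K = c $ 2 * cos (\<alpha> 1) - c $ 1 * sin (\<alpha> 1)"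
  from part have n: "n > 0" and \<alpha>1: "\<alpha> 1 = line_angle c" and \<alpha>n: "\<alpha> (n + 1) = \<alpha> 1 + pi"
    and inc: "\<forall>i\<in>{1..2*n}. \<alpha> i < \<alpha> (i + 1)"
    and const: "\<forall>i\<in>{1..2*n}. \<forall>\<theta>\<in>arc \<alpha> i. \<forall>\<theta>'\<in>arc \<alpha> i. \<forall>x x'.
       polar_angle x \<theta> \<and> polar_angle x' \<theta>' \<longrightarrow> sensor b c x = sensor b c x'"
    by (auto simp: circle_partition_def)
  from inc[rule_format, of 1] n have \<alpha>2: "\<alpha> 1 < \<alpha> 2"
    by (simp add: numeral_2_eq_2)
  have orth: "c $ 1 * cos (\<alpha> 1) + c $ 2 * sin (\<alpha> 1) = 0"
    using line_angle_orthogonal[of c] unfolding \<alpha>1[symmetric] by (simp add: inner_vec_def sum_2)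
  have K: "K \<noteq> 0"
  proof
    assume "K = 0"
    \<comment> \<open>\<open>K\<close> and \<open>c \<bullet> beta (\<alpha> 1)\<close> are the coordinates of \<open>c\<close> in an orthonormal basis\<close>
    have "(c $ 1 * cos (\<alpha> 1) + c $ 2 * sin (\<alpha> 1))\<^sup>2 + K\<^sup>2
        = ((c $ 1)\<^sup>2 + (c $ 2)\<^sup>2) * ((sin (\<alpha> 1))\<^sup>2 + (cos (\<alpha> 1))\<^sup>2)"
      unfolding K_def by algebra
    then have "(c $ 1)\<^sup>2 + (c $ 2)\<^sup>2 = 0"
      using \<open>K = 0\<close> orth unfolding sin_cos_squared_add by simp
    with c show False by (simp add: vec_eq_iff forall_2 sum_power2_eq_zero_iff)
  qed
  have inner: "c \<bullet> beta (\<alpha> 1 + s) = K * sin s" for s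
    using orth unfolding K_def
    by (simp add: inner_vec_def sum_2 cos_add sin_add) algebra
  have interior: "sensor b c (beta (\<alpha> 1 + s)) = (if K > 0 then 1 else - 1)"
    if "0 < s" "s < pi" for s
    using sin_gt_zero[OF that] K
    by (auto simp: sensor_def inner zero_less_mult_iff mult_less_0_iff simp del: One_nat_def)
  \<comment> \<open>an angle inside the first arc and strictly inside the half-circle\<close>
  define s where "s = min (\<alpha> 2 - \<alpha> 1) pi / 2"
  have s: "0 < s" "s < pi" "s < \<alpha> 2 - \<alpha> 1"
    using \<alpha>2 pi_gt_zero by (auto simp: s_def min_def)
  have arcs: "\<alpha> 1 \<in> arc \<alpha> 1" "\<alpha> 1 + s \<in> arc \<alpha> 1"
    using s by (auto simp: arc_def one_add_one[symmetric] simp del: one_add_one)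
  have "1 \<in> {1..2*n}" using n by simp
  with const arcs have start: "sensor b c (beta (\<alpha> 1)) = sensor b c (beta (\<alpha> 1 + s))"
    using polar_angle_beta by blast
  show ?thesis
  proof (cases "\<theta> = \<alpha> 1")
    case False
    with \<theta> \<alpha>n have "0 < \<theta> - \<alpha> 1" "\<theta> - \<alpha> 1 < pi" by auto
    from interior[OF this] interior[OF s(1,2)] start show ?thesis by simp
  qed simp
qed

lemma sensor_second_half:
  assumes c: "c \<noteq> 0" "b \<in> outputs" and part: "circle_partition c b n \<alpha>"
    and \<theta>: "\<theta> \<in> {\<alpha> (n + 1)..<\<alpha> (2 * n + 1)}"
  shows "sensor b c (beta \<theta>) = - sensor b c (beta (\<alpha> 1))"
proof -
  from part have "\<alpha> (n + 1) = \<alpha> 1 + pi" "\<alpha> (2 * n + 1) = \<alpha> 1 + 2 * pi"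
    by (auto simp: circle_partition_def)
  with \<theta> have "\<theta> - pi \<in> {\<alpha> 1..<\<alpha> (n + 1)}" by auto
  then have "sensor b c (beta (\<theta> - pi)) = sensor b c (beta (\<alpha> 1))"
    by (rule sensor_first_half[OF c(1) part])
  moreover have "beta \<theta> = - beta (\<theta> - pi)"
    using beta_add_pi[of "\<theta> - pi"] by simp
  moreover have "beta (\<theta> - pi) \<noteq> 0"
    by (metis norm_beta norm_zero zero_neq_one)
  ultimately show ?thesis using c by (simp add: sensor_minus)
qed

section \<open>States as unions of arcs\<close>

lemma partition_mono:
  assumes part: "circle_partition c b n \<alpha>" and "i \<le> j" "1 \<le> i" "j \<le> 2 * n + 1"
  shows "\<alpha> i \<le> \<alpha> j"
  using assms(2,4)
proof (induction j rule: dec_induct)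
  case (step j)
  with assms(3) have "j \<in> {1..2*n}" by auto
  with part have "\<alpha> j < \<alpha> (j + 1)" by (auto simp: circle_partition_def)
  with step show ?case by simp
qed simp

lemma mem_some_arc: "\<theta> \<in> {\<alpha> 1..<\<alpha> (m + 1)} \<Longrightarrow> \<exists>i\<in>{1..m}. \<theta> \<in> arc \<alpha> i"
proof (induction m)
  case (Suc m)
  show ?case
  proof (cases "\<theta> < \<alpha> (m + 1)")
    case True
    with Suc have "\<exists>i\<in>{1..m}. \<theta> \<in> arc \<alpha> i" by simp
    then show ?thesis by (meson atLeastAtMost_iff le_SucI)
  next
    case False
    with Suc.prems have "\<theta> \<in> arc \<alpha> (Suc m)" by (simp add: arc_def)
    then show ?thesis by (intro bexI[of _ "Suc m"]) simp_all
  qed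
qed simp

lemma arc_subset_whole_circle:
  assumes part: "circle_partition c b n \<alpha>" and "i \<in> {1..2*n}"
  shows "arc \<alpha> i \<subseteq> whole_circle n \<alpha>"
  using partition_mono[OF part, of 1 i] partition_mono[OF part, of "i + 1" "2 * n + 1"] assms(2)
  by (auto simp: arc_def whole_circle_def)

lemma whole_circle_eq_Union_arcs:
  assumes "circle_partition c b n \<alpha>"
  shows "whole_circle n \<alpha> = (\<Union>i\<in>{1..2*n}. arc \<alpha> i)"
proof
  show "whole_circle n \<alpha> \<subseteq> (\<Union>i\<in>{1..2*n}. arc \<alpha> i)"
    using mem_some_arc[of _ \<alpha> "2 * n"] unfolding whole_circle_def by fast
  show "(\<Union>i\<in>{1..2*n}. arc \<alpha> i) \<subseteq> whole_circle n \<alpha>"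
    using arc_subset_whole_circle[OF assms] by fast
qed

lemma actual_state_Union_arcs:
  assumes "circle_partition c b n \<alpha>" and "q \<in> actual_states f c b n \<alpha>"
  obtains J where "J \<subseteq> {1..2*n}" "q = (\<Union>i\<in>J. arc \<alpha> i)"
  using assms(2)
proof cases
  case init
  with whole_circle_eq_Union_arcs[OF assms(1)] show ?thesis by (intro that[of "{1..2*n}"]) auto
next
  case (step q' u y)
  then show ?thesis
    by (intro that[of "hit_arcs f n \<alpha> u (proj c b n \<alpha> y q')"]) (auto simp: fhat_def hit_arcs_def)
qed

lemma finite_actual_states:
  assumes "circle_partition c b n \<alpha>"
  shows "finite (actual_states f c b n \<alpha>)"
proof (rule finite_subset)
  show "actual_states f c b n \<alpha> \<subseteq> (\<lambda>J. \<Union>i\<in>J. arc \<alpha> i) ` Pow {1..2*n}"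
  proof
    fix q assume "q \<in> actual_states f c b n \<alpha>"
    then obtain J where "J \<subseteq> {1..2*n}" "q = (\<Union>i\<in>J. arc \<alpha> i)"
      using actual_state_Union_arcs[OF assms] by metis
    then show "q \<in> (\<lambda>J. \<Union>i\<in>J. arc \<alpha> i) ` Pow {1..2*n}" by blast
  qed
qed simp

lemma actual_state_subset_whole_circle:
  assumes "circle_partition c b n \<alpha>" and "q \<in> actual_states f c b n \<alpha>"
  shows "q \<subseteq> whole_circle n \<alpha>"
proof -
  obtain J where "J \<subseteq> {1..2*n}" "q = (\<Union>i\<in>J. arc \<alpha> i)"
    using actual_state_Union_arcs[OF assms] .
  then show ?thesis using arc_subset_whole_circle[OF assms(1)] by fast
qed

text \<open>Measure enters through the tie-breaking rule of \<open>ghat\<close>: a nonempty state has positive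
  length because it contains an arc.\<close>

lemma actual_state_measure_pos:
  assumes part: "circle_partition c b n \<alpha>" and "q \<in> actual_states f c b n \<alpha>" and "q \<noteq> {}"
  shows "measure lborel q > 0"
proof -
  obtain J where J: "J \<subseteq> {1..2*n}" "q = (\<Union>i\<in>J. arc \<alpha> i)"
    using actual_state_Union_arcs[OF assms(1,2)] .
  with \<open>q \<noteq> {}\<close> obtain i where i: "i \<in> J" by auto
  have inc: "\<alpha> j < \<alpha> (j + 1)" if "j \<in> J" for j
    using part that J(1) by (auto simp: circle_partition_def)
  have "finite J" using J(1) finite_subset by blast
  then have fm: "q \<in> fmeasurable lborel"
    unfolding J(2) using inc
    by (intro fmeasurable.finite_UN) (auto simp: arc_def fmeasurable_def less_imp_le)
  from inc[OF i] have "0 < measure lborel (arc \<alpha> i)" by (simp add: arc_def)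
  also have "\<dots> \<le> measure lborel q"
    using fm i J(2) by (intro measure_mono_fmeasurable) (auto simp: arc_def)
  finally show ?thesis .
qed

section \<open>The angle tracked by the machine\<close>

text \<open>The point whose angle the machine follows when the plant is at \<open>x\<close>.\<close>

definition tracked :: "nat \<Rightarrow> real^2 \<Rightarrow> real^2" where
  "tracked n x = (if n = 1 then - x else x)"

text \<open>The sign in \<open>tracked\<close> is chosen to cancel the exchange of labels in \<open>proj\<close> when \<open>n = 1\<close>.\<close>

lemma mem_proj_iff_sensor:
  assumes c: "c \<noteq> 0" "b \<in> outputs" and part: "circle_partition c b n \<alpha>"
    and ang: "polar_angle (tracked n x) \<theta>"
    and q: "q \<subseteq> whole_circle n \<alpha>" "\<theta> \<in> q"
    and y: "y \<in> outputs"
  shows "\<theta> \<in> proj c b n \<alpha> y q \<longleftrightarrow> y = sensor b c x"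
proof -
  from part have n: "n > 0" and \<alpha>n: "\<alpha> (n + 1) = \<alpha> 1 + pi" "\<alpha> (2 * n + 1) = \<alpha> 1 + 2 * pi"
    and inc: "\<forall>i\<in>{1..2*n}. \<alpha> i < \<alpha> (i + 1)"
    by (auto simp: circle_partition_def)
  have x: "x \<noteq> 0" using ang by (auto simp: polar_angle_def tracked_def split: if_splits)
  have label: "sensor b c (beta (\<alpha> 2)) =
      (if n = 1 then - sensor b c (beta (\<alpha> 1)) else sensor b c (beta (\<alpha> 1)))"
  proof (cases "n = 1")
    case True
    with \<alpha>n have "\<alpha> 2 \<in> {\<alpha> (n + 1)..<\<alpha> (2 * n + 1)}"
      by (auto simp: numeral_eq_Suc)
    from sensor_second_half[OF c part this] True show ?thesis by simp
  next
    case False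
    with n have "2 \<le> n" by simp
    then have "\<alpha> 1 < \<alpha> 2" "\<alpha> 2 < \<alpha> 3" "\<alpha> 3 \<le> \<alpha> (n + 1)"
      using inc[rule_format, of 1] inc[rule_format, of 2] partition_mono[OF part, of 3 "n + 1"]
      by (simp_all add: numeral_2_eq_2 numeral_3_eq_3)
    then have "\<alpha> 2 \<in> {\<alpha> 1..<\<alpha> (n + 1)}" by simp
    from sensor_first_half[OF c(1) part this] False show ?thesis by simp
  qed
  have tr: "sensor b c (beta \<theta>) = (if n = 1 then - sensor b c x else sensor b c x)"
    using sensor_polar_angle[OF ang, of b c] sensor_minus[OF c(1) x c(2)]
    by (auto simp: tracked_def)
  have out: "sensor b c x \<in> outputs" by (rule sensor_outputs[OF c(2)])
  from q have "\<theta> \<in> {\<alpha> 1..<\<alpha> (n + 1)} \<or> \<theta> \<in> {\<alpha> (n + 1)..<\<alpha> (2 * n + 1)}"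
    by (auto simp: whole_circle_def)
  then show ?thesis
  proof
    assume h: "\<theta> \<in> {\<alpha> 1..<\<alpha> (n + 1)}"
    have "sensor b c (beta (\<alpha> 2)) = sensor b c x"
      using sensor_first_half[OF c(1) part h] tr label by presburger
    with h q(2) show ?thesis by (auto simp: proj_def)
  next
    assume h: "\<theta> \<in> {\<alpha> (n + 1)..<\<alpha> (2 * n + 1)}"
    have opposite: "sensor b c (beta (\<alpha> 2)) = - sensor b c x"
      using sensor_second_half[OF c part h] tr label by presburger
    have "\<theta> \<in> proj c b n \<alpha> y q \<longleftrightarrow> sensor b c (beta (\<alpha> 2)) \<noteq> y"
      using h q(2) by (simp add: proj_def)
    also have "\<dots> \<longleftrightarrow> y = sensor b c x"
      unfolding opposite using out y by (rule minus_neq_output_iff)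
    finally show ?thesis .
  qed
qed

text \<open>By homogeneity \<open>f u\<close> maps a ray to a ray as long as it does not vanish there, and it
  commutes with the sign in \<open>tracked\<close>; so the new tracked angle is an image angle of the old
  one, and lies in one of the arcs that make up the next state.\<close>

lemma tracked_angle_step:
  assumes plant: "plant f c b" and part: "circle_partition c b n \<alpha>" and u: "u \<in> inputs"
    and nz: "f u x \<noteq> 0"
    and q: "q \<subseteq> whole_circle n \<alpha>" and \<theta>: "\<theta> \<in> q" "polar_angle (tracked n x) \<theta>"
  shows "\<exists>\<phi>\<in>fhat f c b n \<alpha> q u (sensor b c x). polar_angle (tracked n (f u x)) \<phi>"
proof -
  from plant have c: "c \<noteq> 0" "b \<in> outputs" by (auto simp: plant_def)
  have hom: "f u (a *\<^sub>R z) = a *\<^sub>R f u z" for a z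
    using plant u unfolding plant_def by blast
  have "tracked n (f u x) = f u (tracked n x)"
    using hom[of "- 1" x] by (simp add: tracked_def)
  also have "\<dots> = norm (tracked n x) *\<^sub>R f u (beta \<theta>)"
    using \<theta>(2) hom by (metis polar_angle_def)
  finally have image: "tracked n (f u x) = norm (tracked n x) *\<^sub>R f u (beta \<theta>)" .
  have "tracked n (f u x) \<noteq> 0" using nz by (simp add: tracked_def)
  then obtain \<phi> where \<phi>: "\<phi> \<in> {\<alpha> 1..<\<alpha> 1 + 2 * pi}" "polar_angle (tracked n (f u x)) \<phi>"
    using polar_angle_exists by blast
  have "norm (tracked n x) > 0" using \<theta>(2) by (simp add: polar_angle_def)
  with \<phi>(2) have "polar_angle (f u (beta \<theta>)) \<phi>"
    by (simp add: image polar_angle_scale)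
  moreover have "\<theta> \<in> proj c b n \<alpha> (sensor b c x) q"
    using mem_proj_iff_sensor[OF c part \<theta>(2) q \<theta>(1)] sensor_outputs[OF c(2)] by blast
  ultimately have "\<phi> \<in> image_angles f u (proj c b n \<alpha> (sensor b c x) q)"
    by (auto simp: image_angles_def)
  moreover have "\<phi> \<in> {\<alpha> 1..<\<alpha> (2 * n + 1)}"
    using \<phi>(1) part by (simp add: circle_partition_def)
  then obtain i where "i \<in> {1..2*n}" "\<phi> \<in> arc \<alpha> i"
    using mem_some_arc by blast
  ultimately have "\<phi> \<in> fhat f c b n \<alpha> q u (sensor b c x)"
    by (auto simp: fhat_def hit_arcs_def)
  with \<phi>(2) show ?thesis by blast
qed

text \<open>An unambiguous state lies in one half-circle, and so its other projection is empty.\<close>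

lemma prediction_correct:
  assumes c: "c \<noteq> 0" "b \<in> outputs" and part: "circle_partition c b n \<alpha>"
    and q: "q \<in> actual_states f c b n \<alpha>" and \<theta>: "\<theta> \<in> q" "polar_angle (tracked n x) \<theta>"
    and unambiguous: "ambiguity c b n \<alpha> q = 0"
  shows "ghat c b n \<alpha> q = sensor b c x"
proof (cases "q = proj c b n \<alpha> 1 q")
  case True
  then have "\<theta> \<in> proj c b n \<alpha> 1 q" using \<theta>(1) by simp
  then have "1 = sensor b c x"
    using mem_proj_iff_sensor[OF c part \<theta>(2) actual_state_subset_whole_circle[OF part q] \<theta>(1)]
    by (simp add: outputs_def)
  with True show ?thesis by (simp add: ghat_def)
next
  case False
  with unambiguous have minus: "q = proj c b n \<alpha> (- 1) q"
    by (simp add: ambiguity_def split: if_splits)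
  then have "\<theta> \<in> proj c b n \<alpha> (- 1) q" using \<theta>(1) by simp
  then have "- 1 = sensor b c x"
    using mem_proj_iff_sensor[OF c part \<theta>(2) actual_state_subset_whole_circle[OF part q] \<theta>(1)]
    by (simp add: outputs_def)
  moreover have "measure lborel (proj c b n \<alpha> 1 q) < measure lborel (proj c b n \<alpha> (- 1) q)"
  proof -
    have "proj c b n \<alpha> 1 q \<inter> proj c b n \<alpha> (- 1) q = {}"
      using sensor_outputs[OF c(2), of c "beta (\<alpha> 2)"] by (auto simp: proj_def outputs_def)
    moreover have "proj c b n \<alpha> 1 q \<subseteq> q" by (auto simp: proj_def)
    ultimately have "proj c b n \<alpha> 1 q = {}"
      unfolding minus[symmetric] by blast
    moreover have "measure lborel q > 0"
      using actual_state_measure_pos[OF part q] \<theta>(1) by blast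
    ultimately show ?thesis by (simp flip: minus)
  qed
  ultimately show ?thesis using False by (simp add: ghat_def)
qed

section \<open>The gain condition\<close>

theorem lemma2:
  fixes f :: "nat \<Rightarrow> real^2 \<Rightarrow> real^2" and c :: "real^2" and b :: int
    and n :: nat and \<alpha> :: "nat \<Rightarrow> real"
    and V :: "real set \<Rightarrow> real" and \<gamma> :: real
  assumes "plant f c b"
    and "circle_partition c b n \<alpha>"
    and "0 < \<gamma>" and "\<gamma> < 1"
    and "\<forall>q\<in>actual_states f c b n \<alpha>. \<forall>u\<in>inputs. \<forall>y\<in>outputs.
           V (fhat f c b n \<alpha> q u y) - V q \<le> \<gamma> * rho u - ambiguity c b n \<alpha> q"
  shows "\<forall>u w. feasible f c b n \<alpha> u w \<longrightarrow>
           (INF T. ereal (\<Sum>t\<le>T. \<gamma> * rho (u t) - mu (w t))) > - \<infinity>"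
proof (intro allI impI)
  fix u w
  assume "feasible f c b n \<alpha> u w"
  note feasible = this[unfolded feasible_def]
  have u: "u t \<in> inputs" for t
    using conjunct1[OF feasible] by blast
  from conjunct2[OF feasible] obtain x y v q yhat vhat where plant_run: "plant_run f c b u x y v"
    and machine_run: "machine_run f c b n \<alpha> u y q yhat vhat"
    and w_all: "\<forall>t. w t = (if y t = yhat t then 0 else 1)"
    by metis
  have w: "w t = (if y t = yhat t then 0 else 1)" for t
    using w_all by blast
  let ?Q = "actual_states f c b n \<alpha>"
  from assms(1) have c: "c \<noteq> 0" "b \<in> outputs" by (auto simp: plant_def)
  from plant_run have x: "\<And>t. x t \<noteq> 0" "\<And>t. x (Suc t) = f (u t) (x t)"
    and y: "\<And>t. y t = sensor b c (x t)"
    by (auto simp: plant_run_def)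
  from machine_run have q0: "q 0 = whole_circle n \<alpha>"
    and q_Suc: "\<And>t. q (Suc t) = fhat f c b n \<alpha> (q t) (u t) (y t)"
    and yhat: "\<And>t. yhat t = ghat c b n \<alpha> (q t)"
    by (auto simp: machine_run_def)
  have y_out: "y t \<in> outputs" for t
    using sensor_outputs[OF c(2)] by (simp add: y)
  have q_mem: "q t \<in> ?Q" for t
    by (induction t) (auto simp: q0 q_Suc u y_out intro: actual_states.intros)
  have invariant: "\<exists>\<theta>\<in>q t. polar_angle (tracked n (x t)) \<theta>" for t
  proof (induction t)
    case 0
    have "tracked n (x 0) \<noteq> 0" using x(1) by (simp add: tracked_def)
    then obtain \<theta> where "\<theta> \<in> {\<alpha> 1..<\<alpha> 1 + 2 * pi}" "polar_angle (tracked n (x 0)) \<theta>"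
      using polar_angle_exists by blast
    with assms(2) show ?case by (auto simp: q0 whole_circle_def circle_partition_def)
  next
    case (Suc t)
    then obtain \<theta> where "\<theta> \<in> q t" "polar_angle (tracked n (x t)) \<theta>" by blast
    moreover have "f (u t) (x t) \<noteq> 0" using x by metis
    ultimately show ?case
      using tracked_angle_step[OF assms(1,2) u] actual_state_subset_whole_circle[OF assms(2) q_mem]
      by (simp add: q_Suc x(2) y)
  qed
  have error: "mu (w t) \<le> ambiguity c b n \<alpha> (q t)" for t
  proof (cases "ambiguity c b n \<alpha> (q t) = 0")
    case True
    with invariant[of t] have "yhat t = y t"
      using prediction_correct[OF c assms(2) q_mem] by (auto simp: yhat y)
    with True show ?thesis by (simp add: w mu_def)
  next
    case False
    then have "ambiguity c b n \<alpha> (q t) = 1" by (simp add: ambiguity_def split: if_splits)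
    then show ?thesis by (simp add: w mu_def)
  qed
  have "V (q (Suc t)) - V (q t) \<le> \<gamma> * rho (u t) - mu (w t)" for t
    using assms(5) q_mem[of t] u[of t] y_out[of t] error[of t] by (fastforce simp: q_Suc)
  then have "(\<Sum>t\<le>T. V (q (Suc t)) - V (q t)) \<le> (\<Sum>t\<le>T. \<gamma> * rho (u t) - mu (w t))" for T
    by (intro sum_mono)
  moreover have "(\<Sum>t\<le>T. V (q (Suc t)) - V (q t)) = V (q (Suc T)) - V (q 0)" for T
    by (induction T) simp_all
  ultimately have partial_sums: "V (q (Suc T)) - V (q 0) \<le> (\<Sum>t\<le>T. \<gamma> * rho (u t) - mu (w t))" for T
    by metis
  define B where "B = Min (V ` ?Q) - V (q 0)"
  have "B \<le> (\<Sum>t\<le>T. \<gamma> * rho (u t) - mu (w t))" for T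
    using partial_sums[of T] q_mem[of "Suc T"] finite_actual_states[OF assms(2)]
      Min_le[of "V ` ?Q" "V (q (Suc T))"]
    unfolding B_def by fastforce
  then have "ereal B \<le> (INF T. ereal (\<Sum>t\<le>T. \<gamma> * rho (u t) - mu (w t)))"
    by (intro INF_greatest) simp
  then show "(INF T. ereal (\<Sum>t\<le>T. \<gamma> * rho (u t) - mu (w t))) > - \<infinity>"
    by (rule less_le_trans[rotated]) simp
qed

end
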